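(* Let $f$ be an orientation-preserving harmonic mapping in $\mathbb D$ with $\|\omega_f\|_\infty<1$, and let $q=q_{\mathrm{aff}}(f)\in[0,1)$. Then $$k_{\mathrm{aff}}(f)\ge\frac{q}{1+\sqrt{1-q^2}}$$ and $$k_{\mathrm{aff}}(f)\le j(q):=\frac{2q}{\sqrt{3+q^2}+\sqrt{3(1-q^2)}}.$$ Consequently, $$\sqrt{\frac{1+q}{1-q}}\le K_{\mathrm{aff}}(f)\le\frac{1+j(q)}{1-j(q)}.$$
   Context: $\mathbb D$ is the open unit disk in $\mathbb C$. An orientation-preserving harmonic mapping in $\mathbb D$ is a complex-valued harmonic function $f=h+\overline g$, with $h,g$ analytic in $\mathbb D$, whose Jacobian $|h'|^2-|g'|^2$ is positive everywhere; its complex dilatation $\omega_f=g'/h'$ is an analytic map $\mathbb D\to\mathbb D$. $\|\cdot\|_\infty$ is the supremum norm on $\mathbb D$. Hyperbolic distance: $d_{\mathbb D}(z_1,z_2)=2\operatorname{arctanh}\left|\frac{z_1-z_2}{1-\overline{z_2}z_1}\right|$. For a nonempty hyperbolically bounded $E\subset\mathbb D$: $\operatorname{rad}_{\mathbb D}(E)=\inf_{c\in\mathbb D}\sup_{\zeta\in E}d_{\mathbb D}(c,\zeta)$, $\operatorname{diam}_{\mathbb D}(E)=\sup_{\zeta,\eta\in E}d_{\mathbb D}(\zeta,\eta)$. With $E_f=\overline{\omega_f(\mathbb D)}$: $r_{\mathrm{aff}}(f)=\operatorname{rad}_{\mathbb D}(E_f)$, $d_{\mathrm{aff}}(f)=\operatorname{diam}_{\mathbb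 D}(E_f)$, $k_{\mathrm{aff}}(f)=\tanh(r_{\mathrm{aff}}(f)/2)$, $K_{\mathrm{aff}}(f)=\frac{1+k_{\mathrm{aff}}(f)}{1-k_{\mathrm{aff}}(f)}=e^{r_{\mathrm{aff}}(f)}$, and $q_{\mathrm{aff}}(f)=\tanh(d_{\mathrm{aff}}(f)/2)=\sup_{z,w\in\mathbb D}\left|\frac{\omega_f(z)-\omega_f(w)}{1-\overline{\omega_f(w)}\,\omega_f(z)}\right|$. *)

theory Defs
  imports "HOL-Analysis.Analysis"
begin

abbreviation unit_disk :: "complex set" where
  "unit_disk \<equiv> ball 0 1"

text \<open>Functions are total on the complex plane; only their values on the disk matter.\<close>

definition harmonic_decomp ::
  "(complex \<Rightarrow> complex) \<Rightarrow> (complex \<Rightarrow> complex) \<Rightarrow> (complex \<Rightarrow> complex) \<Rightarrow> bool" where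
  "harmonic_decomp f h g \<longleftrightarrow>
     h holomorphic_on unit_disk \<and> g holomorphic_on unit_disk \<and>
     (\<forall>z\<in>unit_disk. f z = h z + cnj (g z))"

definition orientation_preserving_harmonic :: "(complex \<Rightarrow> complex) \<Rightarrow> bool" where
  "orientation_preserving_harmonic f \<longleftrightarrow>
     (\<exists>h g. harmonic_decomp f h g \<and>
       (\<forall>z\<in>unit_disk. (cmod (deriv h z))\<^sup>2 - (cmod (deriv g z))\<^sup>2 > 0))"

text \<open>
  The functions \<open>h\<close> and \<open>g\<close> are determined by \<open>f\<close> only up to additive constants, but their
  derivatives are unique, so the complex dilatation depends on \<open>f\<close> alone; see
  \<open>dilatation_eq\<close> below.
\<close>

definition dilatation :: "(complex \<Rightarrow> complex) \<Rightarrow> complex \<Rightarrow> complex" where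
  "dilatation f z = (THE w. \<exists>h g. harmonic_decomp f h g \<and> w = deriv g z / deriv h z)"

lemma harmonic_decomp_has_derivative:
  assumes "harmonic_decomp f h g" "z \<in> unit_disk"
  shows "(f has_derivative (\<lambda>v. deriv h z * v + cnj (deriv g z * v))) (at z)"
proof -
  have "(h has_derivative (*) (deriv h z)) (at z)" "(g has_derivative (*) (deriv g z)) (at z)"
    using assms holomorphic_derivI[of _ unit_disk z UNIV]
    by (auto simp: harmonic_decomp_def has_field_derivative_def)
  then have "((\<lambda>z. h z + cnj (g z)) has_derivative
               (\<lambda>v. deriv h z * v + cnj (deriv g z * v))) (at z)"
    by (intro has_derivative_add bounded_linear.has_derivative[OF bounded_linear_cnj])
  then show ?thesis
    by (rule has_derivative_transform_within_open[OF _ open_ball[of 0 1]])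
       (use assms in \<open>auto simp: harmonic_decomp_def\<close>)
qed

lemma harmonic_decomp_deriv_unique:
  assumes "harmonic_decomp f h g" "harmonic_decomp f h' g'" "z \<in> unit_disk"
  shows "deriv h z = deriv h' z" "deriv g z = deriv g' z"
proof -
  have eq: "deriv h z * v + cnj (deriv g z * v) = deriv h' z * v + cnj (deriv g' z * v)" for v
    using has_derivative_unique[OF harmonic_decomp_has_derivative[OF assms(1,3)]
        harmonic_decomp_has_derivative[OF assms(2,3)]] by (rule fun_cong)
  show "deriv h z = deriv h' z" "deriv g z = deriv g' z"
    using eq[of 1] eq[of \<i>] by (simp_all add: complex_eq_iff)
qed

lemma dilatation_eq:
  assumes "harmonic_decomp f h g" "z \<in> unit_disk"
  shows "dilatation f z = deriv g z / deriv h z"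
  unfolding dilatation_def
proof (rule the_equality)
  show "\<exists>h' g'. harmonic_decomp f h' g' \<and> deriv g z / deriv h z = deriv g' z / deriv h' z"
    using assms(1) by blast
next
  fix w assume "\<exists>h' g'. harmonic_decomp f h' g' \<and> w = deriv g' z / deriv h' z"
  then show "w = deriv g z / deriv h z"
    using harmonic_decomp_deriv_unique[OF assms(1) _ assms(2)] by metis
qed

text \<open>Real suprema and infima are junk for unbounded sets; the following one is taken over a
  bounded set whenever \<open>u\<close> is bounded on the disk, e.g. for dilatations of orientation-preserving
  harmonic mappings, which take values in the disk.\<close>

definition sup_norm_disk :: "(complex \<Rightarrow> complex) \<Rightarrow> real" where
  "sup_norm_disk u = (SUP z\<in>unit_disk. cmod (u z))"

definition hyp_dist :: "complex \<Rightarrow> complex \<Rightarrow> real" where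
  "hyp_dist z\<^sub>1 z\<^sub>2 = 2 * artanh (cmod ((z\<^sub>1 - z\<^sub>2) / (1 - cnj z\<^sub>2 * z\<^sub>1)))"

text \<open>The next two are meaningful for nonempty, hyperbolically bounded subsets of the disk.\<close>

definition hyp_rad :: "complex set \<Rightarrow> real" where
  "hyp_rad E = (INF c\<in>unit_disk. SUP \<zeta>\<in>E. hyp_dist c \<zeta>)"

definition hyp_diam :: "complex set \<Rightarrow> real" where
  "hyp_diam E = (SUP (\<zeta>, \<eta>)\<in>E \<times> E. hyp_dist \<zeta> \<eta>)"

definition E_aff :: "(complex \<Rightarrow> complex) \<Rightarrow> complex set" where
  "E_aff f = closure (dilatation f ` unit_disk)"

definition r_aff :: "(complex \<Rightarrow> complex) \<Rightarrow> real" where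
  "r_aff f = hyp_rad (E_aff f)"

definition d_aff :: "(complex \<Rightarrow> complex) \<Rightarrow> real" where
  "d_aff f = hyp_diam (E_aff f)"

definition k_aff :: "(complex \<Rightarrow> complex) \<Rightarrow> real" where
  "k_aff f = tanh (r_aff f / 2)"

definition K_aff :: "(complex \<Rightarrow> complex) \<Rightarrow> real" where
  "K_aff f = (1 + k_aff f) / (1 - k_aff f)"

definition q_aff :: "(complex \<Rightarrow> complex) \<Rightarrow> real" where
  "q_aff f = tanh (d_aff f / 2)"

definition jung :: "real \<Rightarrow> real" where
  "jung q = 2 * q / (sqrt (3 + q\<^sup>2) + sqrt (3 * (1 - q\<^sup>2)))"

end

theory Submission
  imports Defs "HOL-Complex_Analysis.Riemann_Mapping"
begin

text \<open>
  The closure \<open>E\<close> of the range of the dilatation is a compact subset of the disk, so the bounds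
  compare the hyperbolic radius and diameter of a compact set. By compactness \<open>E\<close> has a
  circumcenter, which a Moebius map moves to \<open>0\<close>; then \<open>E\<close> lies in the disk of radius \<open>k\<close>.
  The lower bound is the triangle inequality through the center. For the upper bound (Jung's
  inequality), optimality of the center forces \<open>0\<close> into the convex hull of the points of \<open>E\<close> of
  modulus \<open>k\<close>. By Caratheodory three of them suffice, and one weight is at least \<open>1/3\<close>, so two of
  them are seen from \<open>0\<close> under an angle of at least 120 degrees. Their distance gives
  \<open>3 k\<^sup>2 (1 - q\<^sup>2) \<le> q\<^sup>2 (1 - k\<^sup>2)\<^sup>2\<close>, which is solved for \<open>k\<close>.
\<close>

section \<open>The pseudo-hyperbolic distance\<close>

text \<open>Since \<open>artanh\<close> is increasing on [0, 1), radius and diameter can be computed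
  with this algebraic distance. Phrasing it through \<open>Moebius_function\<close> makes the
  library facts on disk automorphisms apply.\<close>

definition phd :: "complex \<Rightarrow> complex \<Rightarrow> real" where
  "phd z w = cmod (Moebius_function 0 w z)"

lemma hyp_dist_eq: "hyp_dist z w = 2 * artanh (phd z w)"
  by (simp add: hyp_dist_def phd_def Moebius_function_simple)

lemma phd_nonneg: "0 \<le> phd z w"
  by (simp add: phd_def)

lemma phd_lt_1: "\<lbrakk>cmod z < 1; cmod w < 1\<rbrakk> \<Longrightarrow> phd z w < 1"
  by (simp add: phd_def Moebius_function_norm_lt_1)

lemma phd_commute: "phd z w = phd w z"
proof -
  have "cmod (1 - cnj w * z) = cmod (1 - cnj z * w)"
    using complex_mod_cnj[of "1 - cnj w * z"] by (simp add: mult.commute)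
  then show ?thesis
    by (simp add: phd_def Moebius_function_simple norm_divide norm_minus_commute)
qed

lemma one_minus_cnj_mult_nonzero:
  fixes z w :: complex
  assumes "cmod z \<le> 1" "cmod w < 1"
  shows "1 - cnj w * z \<noteq> 0"
proof -
  have "cmod (cnj w * z) \<le> cmod w"
    using assms by (simp add: norm_mult mult_left_le)
  then show ?thesis using assms by auto
qed

text \<open>Turns bounds on the distance into polynomial inequalities in |z - w|, |z| and |w|. For
  |z| = 1 the last term vanishes, so numerator and denominator of \<open>phd\<close> then have equal
  modulus.\<close>

lemma cmod_one_minus_cnj_mult_power2:
  "(cmod (1 - cnj w * z))\<^sup>2 = (cmod (z - w))\<^sup>2 + (1 - (cmod z)\<^sup>2) * (1 - (cmod w)\<^sup>2)"
  unfolding cmod_power2 by (simp add: algebra_simps power2_eq_square)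

lemma phd_le_iff:
  assumes "cmod z \<le> 1" "cmod w < 1"
  shows "phd z w \<le> s \<longleftrightarrow> cmod (z - w) \<le> s * cmod (1 - cnj w * z)"
  using one_minus_cnj_mult_nonzero[OF assms]
  by (simp add: phd_def Moebius_function_simple norm_divide divide_le_eq)

lemma phd_less_iff:
  assumes "cmod z < 1" "cmod w < 1" "0 \<le> s"
  shows "phd z w < s \<longleftrightarrow>
    (cmod (z - w))\<^sup>2 * (1 - s\<^sup>2) < s\<^sup>2 * ((1 - (cmod z)\<^sup>2) * (1 - (cmod w)\<^sup>2))"
proof -
  have "1 - cnj w * z \<noteq> 0"
    using one_minus_cnj_mult_nonzero[of z w] assms by simp
  then have "phd z w < s \<longleftrightarrow> cmod (z - w) < s * cmod (1 - cnj w * z)"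
    by (simp add: phd_def Moebius_function_simple norm_divide divide_less_eq)
  also have "\<dots> \<longleftrightarrow> (cmod (z - w))\<^sup>2 < (s * cmod (1 - cnj w * z))\<^sup>2"
    using power_mono_iff[of "s * cmod (1 - cnj w * z)" "cmod (z - w)" 2] assms(3)
    by (simp only: flip: not_le) simp
  also have "\<dots> \<longleftrightarrow> (cmod (z - w))\<^sup>2 * (1 - s\<^sup>2) < s\<^sup>2 * ((1 - (cmod z)\<^sup>2) * (1 - (cmod w)\<^sup>2))"
    unfolding power_mult_distrib cmod_one_minus_cnj_mult_power2 by (simp add: algebra_simps)
  finally show ?thesis .
qed

text \<open>Numerator and denominator both acquire the factor 1 - |c|^2, and their new denominators
  \<open>A * B\<close> and \<open>A * cnj B\<close> have the same modulus, so everything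
  cancels.\<close>

lemma phd_Moebius:
  assumes "cmod c < 1" "cmod z < 1" "cmod w < 1"
  shows "phd (Moebius_function 0 c z) (Moebius_function 0 c w) = phd z w"
proof -
  define A B where "A = 1 - cnj c * z" and "B = 1 - cnj c * w"
  have nz: "A \<noteq> 0" "B \<noteq> 0"
    using one_minus_cnj_mult_nonzero[of z c] one_minus_cnj_mult_nonzero[of w c] assms
    by (simp_all add: A_def B_def)
  then have nz': "cnj B \<noteq> 0" by simp
  have C: "1 - cnj c * c \<noteq> 0" and D: "1 - cnj w * z \<noteq> 0"
    using one_minus_cnj_mult_nonzero[of c c] one_minus_cnj_mult_nonzero[of z w] assms by auto
  have num: "(z - c) / A - (w - c) / B = (z - w) * (1 - cnj c * c) / (A * B)"
    using nz by (simp add: A_def B_def field_simps)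
  have den: "1 - cnj ((w - c) / B) * ((z - c) / A)
      = (1 - cnj w * z) * (1 - cnj c * c) / (A * cnj B)"
  proof -
    have "1 - cnj ((w - c) / B) * ((z - c) / A)
        = (A * cnj B - (cnj w - cnj c) * (z - c)) / (A * cnj B)"
      using nz nz' by (simp add: field_simps)
    also have "A * cnj B - (cnj w - cnj c) * (z - c) = (1 - cnj w * z) * (1 - cnj c * c)"
      by (simp add: A_def B_def algebra_simps)
    finally show ?thesis .
  qed
  show ?thesis
    unfolding phd_def Moebius_function_simple A_def[symmetric] B_def[symmetric] num den
    using nz C D by (simp add: norm_divide norm_mult)
qed

lemma continuous_on_phd:
  assumes "E \<subseteq> ball 0 1" "c \<in> ball 0 1"
  shows "continuous_on E (phd c)"
proof -
  have "1 - cnj w * c \<noteq> 0" if "w \<in> E" for w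
    using one_minus_cnj_mult_nonzero[of c w] assms that by (auto simp: subset_eq)
  then show ?thesis
    unfolding phd_def[abs_def] Moebius_function_simple by (intro continuous_intros) auto
qed

section \<open>Configurations on a sphere with the center in their hull\<close>

text \<open>Let n be the dimension. Of at most n + 1 convex weights, some u(a) is at least 1/(n +
  1). Pairing the combination that yields 0 with a shows that the weighted mean of a \<bullet> x
  over the other points is -u(a) k^2 / (1 - u(a)), which is at most -k^2 / n; hence some b lies at
  or below this mean.\<close>

lemma zero_in_hull_sphere_pair:
  fixes T :: "'a::euclidean_space set"
  assumes "0 \<in> convex hull T" "T \<subseteq> sphere 0 k"
  obtains a b where "a \<in> T" "b \<in> T" "a \<bullet> b \<le> - (k\<^sup>2 / real DIM('a))"
proof -
  define n where "n = real DIM('a)"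
  have n: "n > 0" by (simp add: n_def)
  obtain S where S: "finite S" "S \<subseteq> T" "card S \<le> DIM('a) + 1" "0 \<in> convex hull S"
    using assms(1) by (auto simp: caratheodory[of T])
  then obtain u where u: "\<And>x. x \<in> S \<Longrightarrow> 0 \<le> u x" "sum u S = 1" "(\<Sum>x\<in>S. u x *\<^sub>R x) = 0"
    by (auto simp: convex_hull_finite)
  have "\<exists>a\<in>S. 1 \<le> (n + 1) * u a"
  proof (rule ccontr)
    assume "\<not> ?thesis"
    then have less: "(n + 1) * u a < 1" if "a \<in> S" for a using that by force
    have "S \<noteq> {}" using u(2) by auto
    have "n + 1 = (\<Sum>a\<in>S. (n + 1) * u a)" by (simp add: u(2) flip: sum_distrib_left)
    also have "\<dots> < (\<Sum>a\<in>S. 1)"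
      using less S(1) \<open>S \<noteq> {}\<close> by (intro sum_strict_mono) auto
    also have "\<dots> \<le> n + 1" using S(3) by (simp add: n_def)
    finally show False by simp
  qed
  then obtain a where a: "a \<in> S" "1 \<le> (n + 1) * u a" by blast
  have aa: "a \<bullet> a = k\<^sup>2"
    using a S assms(2) by (force simp: power2_norm_eq_inner[symmetric])
  have rest: "sum u (S - {a}) = 1 - u a"
    using S(1) a u(2) by (simp add: sum_diff1)
  have eq: "(\<Sum>x\<in>S - {a}. u x * (a \<bullet> x)) = - u a * k\<^sup>2"
  proof -
    have "0 = a \<bullet> (\<Sum>x\<in>S. u x *\<^sub>R x)" by (simp add: u(3))
    also have "\<dots> = u a * k\<^sup>2 + (\<Sum>x\<in>S - {a}. u x * (a \<bullet> x))"
      using S(1) a aa by (simp add: inner_add_right inner_sum_right sum.remove)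
    finally show ?thesis by simp
  qed
  have "\<exists>b\<in>S. a \<bullet> b \<le> - (k\<^sup>2 / n)"
  proof (rule ccontr)
    assume neg: "\<not> ?thesis"
    \<comment> \<open>For k = 0 the choice b = a would already do.\<close>
    have k: "k\<^sup>2 > 0"
    proof (rule ccontr)
      assume "\<not> k\<^sup>2 > 0"
      then have "a \<bullet> a \<le> - (k\<^sup>2 / n)" using aa by simp
      then show False using neg a by blast
    qed
    show False
    \<comment> \<open>If a carried the whole weight, the combination would be a itself, which is
      nonzero; otherwise the other weights have a positive sum.\<close>
    proof (cases "u a = 1")
      case True
      then have "\<forall>x\<in>S - {a}. u x = 0"
        using rest S(1) u(1) sum_nonneg_eq_0_iff[of "S - {a}" u] by auto
      then show False using eq True k by simp
    next
      case False
      have "(\<Sum>x\<in>S - {a}. u x * (- (k\<^sup>2 / n))) < (\<Sum>x\<in>S - {a}. u x * (a \<bullet> x))"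
      proof (rule sum_strict_mono_ex1)
        show "\<forall>x\<in>S - {a}. u x * (- (k\<^sup>2 / n)) \<le> u x * (a \<bullet> x)"
          using u(1) neg by (intro ballI mult_left_mono) force+
        have "\<exists>x\<in>S - {a}. u x \<noteq> 0"
        proof (rule ccontr)
          assume "\<not> ?thesis"
          then have "sum u (S - {a}) = 0" by simp
          then show False using rest False by simp
        qed
        then obtain x where x: "x \<in> S - {a}" "u x \<noteq> 0" by blast
        then have "0 < u x" "- (k\<^sup>2 / n) < a \<bullet> x"
          using u(1)[of x] neg by (auto simp: not_le)
        then show "\<exists>x\<in>S - {a}. u x * (- (k\<^sup>2 / n)) < u x * (a \<bullet> x)"
          using x(1) by (intro bexI[of _ x] mult_strict_left_mono)
      qed (use S in auto)
      then have "(1 - u a) * (- (k\<^sup>2 / n)) < - u a * k\<^sup>2"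
        by (simp only: eq rest flip: sum_distrib_right)
      then have "k\<^sup>2 * ((n + 1) * u a) < k\<^sup>2 * 1"
        using n by (simp add: field_simps)
      then show False using k a(2) by (simp only: mult_less_cancel_left_pos)
    qed
  qed
  then show ?thesis using that a(1) S(2) n_def by blast
qed

section \<open>Circumcenters\<close>

text \<open>Here \<open>k\<close> is the infimum over all centers of the largest distance to a point
  of \<open>E\<close>. A minimizing sequence of centers has a limit in the closed disk, and
  \<open>k < 1\<close> keeps that limit off the unit circle.\<close>

lemma circumcenter_exists:
  assumes E: "compact E" "E \<noteq> {}" "E \<subseteq> ball 0 1"
  obtains c k where "c \<in> ball 0 1" "0 \<le> k" "k < 1" "\<And>\<zeta>. \<zeta> \<in> E \<Longrightarrow> phd c \<zeta> \<le> k"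
    "\<And>c'. c' \<in> ball 0 1 \<Longrightarrow> \<exists>\<zeta>\<in>E. k \<le> phd c' \<zeta>"
proof -
  have "\<exists>\<zeta>\<in>E. \<forall>\<eta>\<in>E. phd c \<eta> \<le> phd c \<zeta>" if "c \<in> ball 0 1" for c
    using continuous_attains_sup[OF E(1,2) continuous_on_phd[OF E(3) that]] .
  then obtain \<mu> where \<mu>: "\<And>c. c \<in> ball 0 1 \<Longrightarrow> \<mu> c \<in> E"
    "\<And>c \<eta>. \<lbrakk>c \<in> ball 0 1; \<eta> \<in> E\<rbrakk> \<Longrightarrow> phd c \<eta> \<le> phd c (\<mu> c)"
    by metis
  define V where "V = (\<lambda>c. phd c (\<mu> c)) ` ball 0 1"
  define k where "k = Inf V"
  have V: "V \<noteq> {}" "bdd_below V"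
    unfolding V_def by (auto intro!: bdd_belowI2[where m = 0] phd_nonneg)
  have k_le: "k \<le> phd c (\<mu> c)" if "c \<in> ball 0 1" for c
    unfolding k_def using V that by (intro cInf_lower) (auto simp: V_def)
  have "0 \<le> k"
    unfolding k_def using V by (intro cInf_greatest) (auto simp: V_def phd_nonneg)
  \<comment> \<open>The center 0 already has all of \<open>E\<close> within a distance below
    1.\<close>
  have "k < 1"
    using k_le[of 0] phd_lt_1[of 0 "\<mu> 0"] \<mu>(1)[of 0] E(3) by fastforce
  have "\<exists>c\<in>ball 0 1. phd c (\<mu> c) < k + 1 / real (Suc n)" for n
    using cInf_lessD[OF V(1), of "k + 1 / real (Suc n)"] by (auto simp: V_def k_def)
  then obtain C where C: "\<And>n. C n \<in> ball 0 1"
    "\<And>n. phd (C n) (\<mu> (C n)) < k + 1 / real (Suc n)"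
    by metis
  have "seq_compact (cball (0::complex) 1)"
    by (simp add: compact_imp_seq_compact)
  moreover have "\<forall>n. C n \<in> cball 0 1"
    using C(1) by (auto intro: less_imp_le)
  ultimately obtain c r where c: "c \<in> cball 0 1" "strict_mono r" "(C \<circ> r) \<longlonglongrightarrow> c"
    unfolding seq_compact_def by blast
  \<comment> \<open>The inequality is multiplied out before the limit is taken, because
    \<open>c\<close> may still lie on the unit circle at this stage.\<close>
  have le: "cmod (c - \<zeta>) \<le> k * cmod (1 - cnj \<zeta> * c)" if "\<zeta> \<in> E" for \<zeta>
  proof (rule LIMSEQ_le)
    show "(\<lambda>n. cmod ((C \<circ> r) n - \<zeta>)) \<longlonglongrightarrow> cmod (c - \<zeta>)"
      by (intro tendsto_intros c)
    have "(\<lambda>n. k + 1 / real (Suc (r n))) \<longlonglongrightarrow> k + 0"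
      using LIMSEQ_subseq_LIMSEQ[OF LIMSEQ_Suc[OF lim_1_over_n] c(2)]
      by (intro tendsto_intros) (simp add: o_def)
    then show "(\<lambda>n. (k + 1 / real (Suc (r n))) * cmod (1 - cnj \<zeta> * (C \<circ> r) n))
        \<longlonglongrightarrow> k * cmod (1 - cnj \<zeta> * c)"
      by (intro tendsto_intros c) simp
    have "cmod ((C \<circ> r) n - \<zeta>) \<le> (k + 1 / real (Suc (r n))) * cmod (1 - cnj \<zeta> * (C \<circ> r) n)" for n
    proof -
      have "phd (C (r n)) \<zeta> \<le> k + 1 / real (Suc (r n))"
        using \<mu>(2)[OF C(1) that] C(2)[of "r n"] by (meson order.trans less_imp_le)
      moreover have "cmod (C (r n)) < 1" "cmod \<zeta> < 1"
        using C(1)[of "r n"] that E(3) by auto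
      ultimately show ?thesis by (simp add: phd_le_iff)
    qed
    then show "\<exists>N. \<forall>n\<ge>N. cmod ((C \<circ> r) n - \<zeta>) \<le>
        (k + 1 / real (Suc (r n))) * cmod (1 - cnj \<zeta> * (C \<circ> r) n)" by blast
  qed
  obtain \<zeta>0 where \<zeta>0: "\<zeta>0 \<in> E" "cmod \<zeta>0 < 1" using E by force
  have "cmod c \<noteq> 1"
  proof
    \<comment> \<open>On the unit circle both sides of the limit inequality have the same modulus.\<close>
    assume "cmod c = 1"
    then have "(cmod (1 - cnj \<zeta>0 * c))\<^sup>2 = (cmod (c - \<zeta>0))\<^sup>2"
      by (simp add: cmod_one_minus_cnj_mult_power2)
    then have "cmod (1 - cnj \<zeta>0 * c) \<le> k * cmod (1 - cnj \<zeta>0 * c)"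
      using le[OF \<zeta>0(1)] by (simp add: power2_eq_iff_nonneg)
    moreover have "cmod (1 - cnj \<zeta>0 * c) > 0"
      using one_minus_cnj_mult_nonzero[of c \<zeta>0] \<zeta>0 \<open>cmod c = 1\<close> by simp
    ultimately show False using \<open>k < 1\<close> by simp
  qed
  then have cb: "c \<in> ball 0 1" using c(1) by auto
  show ?thesis
  proof
    show "phd c \<zeta> \<le> k" if "\<zeta> \<in> E" for \<zeta>
      using le[OF that] phd_le_iff[of c \<zeta> k] cb that E(3) by auto
    show "\<exists>\<zeta>\<in>E. k \<le> phd c' \<zeta>" if "c' \<in> ball 0 1" for c'
      using \<mu>(1) k_le that by blast
  qed fact+
qed

text \<open>If the hull missed the center, moving the center slightly towards the extremal points
  would decrease the radius.\<close>

lemma circumcenter_in_hull: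
  assumes S: "compact S" "S \<subseteq> cball 0 k" "0 \<le> k" "k < 1"
    and opt: "\<And>c. c \<in> ball 0 1 \<Longrightarrow> \<exists>\<zeta>\<in>S. k \<le> phd c \<zeta>"
  shows "0 \<in> convex hull (S \<inter> sphere 0 k)"
proof (rule ccontr)
  assume n0: "0 \<notin> convex hull (S \<inter> sphere 0 k)"
  have "compact (convex hull (S \<inter> sphere 0 k))"
    using S(1) by (intro compact_convex_hull compact_Int_closed) auto
  then obtain a b where ab: "a \<noteq> 0" "0 < b" "\<And>x. x \<in> convex hull (S \<inter> sphere 0 k) \<Longrightarrow> b < a \<bullet> x"
    using separating_hyperplane_closed_0[OF convex_convex_hull compact_imp_closed n0] by blast
  \<comment> \<open>These are the points from which a move in direction \<open>a\<close> may lead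
    away. None of them has modulus \<open>k\<close>, so by compactness their moduli stay below
    \<open>k\<close> by a fixed margin, expressed by \<open>m\<close>.\<close>
  define F where "F = S \<inter> {x. a \<bullet> x \<le> b}"
  have F: "compact F"
    unfolding F_def using S(1) by (intro compact_Int_closed closed_halfspace_le)
  have "\<exists>m<k\<^sup>2. \<forall>x\<in>F. (cmod x)\<^sup>2 \<le> m"
  proof (cases "F = {}")
    case True
    then show ?thesis by (auto intro: exI[of _ "k\<^sup>2 - 1"])
  next
    case False
    have "continuous_on F (\<lambda>x. (cmod x)\<^sup>2)" by (intro continuous_intros)
    then obtain y where y: "y \<in> F" "\<forall>x\<in>F. (cmod x)\<^sup>2 \<le> (cmod y)\<^sup>2"
      using continuous_attains_sup[OF F False] by blast
    have "cmod y \<noteq> k"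
      using y(1) ab(3)[OF hull_inc, of y] by (force simp: F_def)
    moreover have "cmod y \<le> k" using y(1) S(2) by (auto simp: F_def)
    ultimately have "(cmod y)\<^sup>2 < k\<^sup>2" by (intro power_strict_mono) auto
    then show ?thesis using y by blast
  qed
  then obtain m where m: "m < k\<^sup>2" "\<And>x. x \<in> F \<Longrightarrow> (cmod x)\<^sup>2 \<le> m" by blast
  have k1: "k\<^sup>2 < 1" using S by (simp add: power_less_one_iff)
  define A where "A = cmod a"
  have "A > 0" using ab by (simp add: A_def)
  \<comment> \<open>Three conditions on a small step \<open>t\<close>: the margin of the points in
    \<open>F\<close> absorbs the displacement, the first-order gain at the other points beats the
    quadratic error, and the new center \<open>t *\<^sub>R a\<close> stays in the disk.\<close>
  have lim: "((\<lambda>t. k\<^sup>2 - m - 2 * t * A - t\<^sup>2 * A\<^sup>2) \<longlongrightarrow> k\<^sup>2 - m - 2 * 0 * A - 0\<^sup>2 * A\<^sup>2) (at_right 0)"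
    "((\<lambda>t. 2 * b * (1 - k\<^sup>2) - t * A\<^sup>2) \<longlongrightarrow> 2 * b * (1 - k\<^sup>2) - 0 * A\<^sup>2) (at_right 0)"
    "((\<lambda>t. 1 - t * A) \<longlongrightarrow> 1 - 0 * A) (at_right 0)"
    by (intro tendsto_intros)+
  have "eventually (\<lambda>t. 0 < k\<^sup>2 - m - 2 * t * A - t\<^sup>2 * A\<^sup>2) (at_right 0)"
    "eventually (\<lambda>t. 0 < 2 * b * (1 - k\<^sup>2) - t * A\<^sup>2) (at_right 0)"
    "eventually (\<lambda>t. 0 < 1 - t * A) (at_right 0)"
    using m(1) ab(2) k1 by (auto intro!: order_tendstoD(1)[OF lim(1)]
        order_tendstoD(1)[OF lim(2)] order_tendstoD(1)[OF lim(3)] simp del: diff_gt_0_iff_gt)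
  moreover have "eventually (\<lambda>t::real. 0 < t) (at_right 0)"
    by (simp add: eventually_at_right_less)
  ultimately have "eventually (\<lambda>t. 0 < t \<and> 0 < k\<^sup>2 - m - 2 * t * A - t\<^sup>2 * A\<^sup>2 \<and>
      0 < 2 * b * (1 - k\<^sup>2) - t * A\<^sup>2 \<and> 0 < 1 - t * A) (at_right 0)"
    by eventually_elim simp
  then obtain t where t: "0 < t" "0 < k\<^sup>2 - m - 2 * t * A - t\<^sup>2 * A\<^sup>2"
    "0 < 2 * b * (1 - k\<^sup>2) - t * A\<^sup>2" "0 < 1 - t * A"
    using eventually_happens[of _ "at_right (0::real)"] by auto
  define c where "c = t *\<^sub>R a"
  have cmod_c: "cmod c = t * A" using t by (simp add: c_def A_def)
  have "phd c \<zeta> < k" if "\<zeta> \<in> S" for \<zeta>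
  proof -
    have z: "cmod \<zeta> \<le> k" using that S by auto
    then have zz: "(cmod \<zeta>)\<^sup>2 \<le> k\<^sup>2" by (simp add: power_mono)
    \<comment> \<open>The left side is positive exactly when \<open>phd c \<zeta> < k\<close>. On
      the right, the linear term in \<open>t\<close> is the effect of moving towards
      \<open>a\<close>, and the last term is an error of order \<open>t\<^sup>2\<close>.\<close>
    have split: "k\<^sup>2 * ((1 - (cmod c)\<^sup>2) * (1 - (cmod \<zeta>)\<^sup>2)) - (cmod (c - \<zeta>))\<^sup>2 * (1 - k\<^sup>2)
      = (k\<^sup>2 - (cmod \<zeta>)\<^sup>2) + 2 * t * (a \<bullet> \<zeta>) * (1 - k\<^sup>2)
        - (t * A)\<^sup>2 * (1 - k\<^sup>2 * (cmod \<zeta>)\<^sup>2)"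
    proof -
      have poly: "K * ((1 - C) * (1 - Z)) - (C - 2 * t * i + Z) * (1 - K)
          = (K - Z) + 2 * t * i * (1 - K) - C * (1 - K * Z)" for K C Z i :: real
        by (simp add: algebra_simps)
      have dist: "(cmod (c - \<zeta>))\<^sup>2 = (t * A)\<^sup>2 - 2 * t * (a \<bullet> \<zeta>) + (cmod \<zeta>)\<^sup>2"
        unfolding power2_norm_eq_inner cmod_c[symmetric]
        by (simp add: c_def inner_diff inner_commute[of \<zeta> a] right_diff_distrib)
      show ?thesis unfolding cmod_c dist by (rule poly)
    qed
    have quad: "(t * A)\<^sup>2 * (1 - k\<^sup>2 * (cmod \<zeta>)\<^sup>2) \<le> (t * A)\<^sup>2"
      by (intro mult_left_le) auto
    have "0 < (k\<^sup>2 - (cmod \<zeta>)\<^sup>2) + 2 * t * (a \<bullet> \<zeta>) * (1 - k\<^sup>2) - (t * A)\<^sup>2"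
    proof (cases "\<zeta> \<in> F")
      case True
      have "\<bar>a \<bullet> \<zeta>\<bar> \<le> A * cmod \<zeta>"
        unfolding A_def by (rule Cauchy_Schwarz_ineq2)
      also have "\<dots> \<le> A" using z S(4) \<open>A > 0\<close> by (intro mult_left_le) auto
      finally have "\<bar>(a \<bullet> \<zeta>) * (1 - k\<^sup>2)\<bar> \<le> A * 1"
        unfolding abs_mult using k1 \<open>A > 0\<close> by (intro mult_mono) auto
      then have "t * - A \<le> t * ((a \<bullet> \<zeta>) * (1 - k\<^sup>2))"
        using t(1) by (intro mult_left_mono) auto
      then show ?thesis using t(2) m(2)[OF True] by (simp add: power_mult_distrib algebra_simps)
    next
      case False
      then have "b < a \<bullet> \<zeta>" using that by (simp add: F_def)
      then have "2 * t * b * (1 - k\<^sup>2) \<le> 2 * t * (a \<bullet> \<zeta>) * (1 - k\<^sup>2)"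
        using t k1 by (intro mult_right_mono mult_left_mono) auto
      moreover have "0 < t * (2 * b * (1 - k\<^sup>2) - t * A\<^sup>2)"
        using t by simp
      ultimately show ?thesis
        using zz by (simp add: power_mult_distrib power2_eq_square algebra_simps)
    qed
    then show ?thesis
      using split quad z S(3,4) t(4) by (subst phd_less_iff) (auto simp: cmod_c)
  qed
  moreover have "c \<in> ball 0 1" using t(4) by (simp add: cmod_c)
  ultimately show False using opt by force
qed

section \<open>Radius and diameter in the hyperbolic disk\<close>

lemma artanh_mono:
  fixes x y :: real
  assumes "0 \<le> x" "x \<le> y" "y < 1"
  shows "artanh x \<le> artanh y"
proof -
  have "(1 + x) / (1 - x) \<le> (1 + y) / (1 - y)"
    using assms by (intro frac_le) auto
  then show ?thesis using assms by (simp add: artanh_def)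
qed

lemma tanh_artanh:
  fixes x :: real
  assumes "\<bar>x\<bar> < 1"
  shows "tanh (artanh x) = x"
proof -
  have "exp (- (2 * artanh x)) = (1 - x) / (1 + x)"
    using assms by (simp add: artanh_def exp_minus)
  moreover have "(1 - (1 - x) / (1 + x)) / (1 + (1 - x) / (1 + x)) = x"
    using assms by (simp add: field_simps)
  ultimately show ?thesis
    by (simp add: tanh_real_altdef)
qed

text \<open>Monotonicity of \<open>artanh\<close> transfers the minimax value. A real supremum is
  informative only over a bounded set; compactness provides this, since the largest distance from a
  center is attained and hence below 1.\<close>

lemma hyp_rad_eq:
  assumes E: "E \<subseteq> ball 0 1" "E \<noteq> {}" and c: "c \<in> ball 0 1" and k: "0 \<le> k" "k < 1"
    and le: "\<And>\<zeta>. \<zeta> \<in> E \<Longrightarrow> phd c \<zeta> \<le> k"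
    and opt: "\<And>c'. c' \<in> ball 0 1 \<Longrightarrow> \<exists>\<zeta>\<in>E. k \<le> phd c' \<zeta>"
    and cpt: "compact E"
  shows "hyp_rad E = 2 * artanh k"
proof -
  have lower: "2 * artanh k \<le> (SUP \<zeta>\<in>E. hyp_dist c' \<zeta>)" if c': "c' \<in> ball 0 1" for c'
  proof -
    obtain \<zeta> where z: "\<zeta> \<in> E" "k \<le> phd c' \<zeta>" using opt c' by blast
    obtain \<eta> where y: "\<eta> \<in> E" "\<And>\<xi>. \<xi> \<in> E \<Longrightarrow> phd c' \<xi> \<le> phd c' \<eta>"
      using continuous_attains_sup[OF cpt E(2) continuous_on_phd[OF E(1) c']] by blast
    have lt1: "phd c' \<xi> < 1" if "\<xi> \<in> E" for \<xi>
      using phd_lt_1 that c' E(1) by auto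
    have "bdd_above (hyp_dist c' ` E)"
      using y lt1 by (intro bdd_aboveI2[where M = "2 * artanh (phd c' \<eta>)"])
        (auto simp: hyp_dist_eq phd_nonneg intro!: artanh_mono)
    moreover have "2 * artanh k \<le> hyp_dist c' \<zeta>"
      using z k lt1 by (simp add: hyp_dist_eq artanh_mono)
    ultimately show ?thesis using z(1) by (intro cSUP_upper2)
  qed
  moreover have "(SUP \<zeta>\<in>E. hyp_dist c \<zeta>) \<le> 2 * artanh k"
    using E le k by (intro cSUP_least) (auto simp: hyp_dist_eq phd_nonneg intro!: artanh_mono)
  ultimately show ?thesis
    unfolding hyp_rad_def using c by (intro cInf_eq_minimum) (force intro: antisym)+
qed

text \<open>An actual diametral pair yields the lower bound for the radius, and its maximality
  yields the upper bound.\<close>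

lemma hyp_diam_attained:
  assumes E: "compact E" "E \<noteq> {}" "E \<subseteq> ball 0 1"
  obtains z w where "z \<in> E" "w \<in> E" "hyp_diam E = 2 * artanh (phd z w)"
    "\<And>z' w'. \<lbrakk>z' \<in> E; w' \<in> E\<rbrakk> \<Longrightarrow> phd z' w' \<le> phd z w"
proof -
  have "continuous_on (E \<times> E) (\<lambda>p. phd (fst p) (snd p))"
  proof -
    have "1 - cnj (snd p) * fst p \<noteq> 0" if "p \<in> E \<times> E" for p
      using one_minus_cnj_mult_nonzero[of "fst p" "snd p"] that E(3) by (force simp: subset_eq)
    then show ?thesis
      unfolding phd_def Moebius_function_simple by (intro continuous_intros) auto
  qed
  then have "\<exists>p\<in>E \<times> E. \<forall>p'\<in>E \<times> E. phd (fst p') (snd p') \<le> phd (fst p) (snd p)"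
    using E by (intro continuous_attains_sup compact_Times) auto
  then obtain p where p: "p \<in> E \<times> E"
    "\<And>p'. p' \<in> E \<times> E \<Longrightarrow> phd (fst p') (snd p') \<le> phd (fst p) (snd p)"
    by blast
  define z w where "z = fst p" and "w = snd p"
  have zw: "z \<in> E" "w \<in> E" "\<And>z' w'. \<lbrakk>z' \<in> E; w' \<in> E\<rbrakk> \<Longrightarrow> phd z' w' \<le> phd z w"
    using p by (auto simp: z_def w_def)
  moreover have "hyp_diam E = 2 * artanh (phd z w)"
    unfolding hyp_diam_def
  proof (rule cSup_eq_maximum)
    show "2 * artanh (phd z w) \<in> (\<lambda>(\<zeta>, \<eta>). hyp_dist \<zeta> \<eta>) ` (E \<times> E)"
      using zw by (force simp: hyp_dist_eq)
    show "x \<le> 2 * artanh (phd z w)" if "x \<in> (\<lambda>(\<zeta>, \<eta>). hyp_dist \<zeta> \<eta>) ` (E \<times> E)" for x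
    proof -
      from that obtain z' w' where "z' \<in> E" "w' \<in> E" "x = 2 * artanh (phd z' w')"
        by (auto simp: hyp_dist_eq)
      moreover have "phd z w < 1" using zw E(3) by (intro phd_lt_1) auto
      ultimately show ?thesis using zw(3)[of z' w'] by (simp add: artanh_mono phd_nonneg)
    qed
  qed
  ultimately show ?thesis using that by blast
qed

text \<open>Points u, v at distance s satisfy |u - v|^2 (1 - s^2) = s^2 (1 - |u|^2) (1 - |v|^2). The
  first polynomial inequality applies this to a diametral pair inside the disk of radius
  \<open>k\<close>, where |u - v| is at most 2k; the second to two points of modulus
  \<open>k\<close> with |a - b|^2 at least 3 k^2.\<close>

lemma hyperbolic_jung:
  assumes E: "compact E" "E \<noteq> {}" "E \<subseteq> ball 0 1"
  defines "k \<equiv> tanh (hyp_rad E / 2)" and "q \<equiv> tanh (hyp_diam E / 2)"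
  shows "0 \<le> k" "k < 1" "0 \<le> q" "q < 1"
    "q\<^sup>2 * (1 - k\<^sup>2)\<^sup>2 \<le> (2 * k)\<^sup>2 * (1 - q\<^sup>2)"
    "3 * k\<^sup>2 * (1 - q\<^sup>2) \<le> q\<^sup>2 * (1 - k\<^sup>2)\<^sup>2"
proof -
  obtain c k' where c: "c \<in> ball 0 1" and k': "0 \<le> k'" "k' < 1"
    and le: "\<And>\<zeta>. \<zeta> \<in> E \<Longrightarrow> phd c \<zeta> \<le> k'"
    and opt: "\<And>c'. c' \<in> ball 0 1 \<Longrightarrow> \<exists>\<zeta>\<in>E. k' \<le> phd c' \<zeta>"
    using circumcenter_exists[OF E] by metis
  have k: "k = k'"
    using hyp_rad_eq[OF E(3,2) c k' le opt E(1)] k' by (simp add: k_def tanh_artanh)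
  show k01: "0 \<le> k" "k < 1" using k k' by auto
  obtain z w where zw: "z \<in> E" "w \<in> E" "hyp_diam E = 2 * artanh (phd z w)"
    and zw_max: "\<And>z' w'. \<lbrakk>z' \<in> E; w' \<in> E\<rbrakk> \<Longrightarrow> phd z' w' \<le> phd z w"
    using hyp_diam_attained[OF E] by metis
  have E1: "cmod \<zeta> < 1" if "\<zeta> \<in> E" for \<zeta> using that E(3) by auto
  have q: "q = phd z w"
    using zw phd_lt_1[of z w] E1 phd_nonneg[of z w] by (simp add: q_def tanh_artanh)
  show q01: "0 \<le> q" "q < 1" using q phd_nonneg phd_lt_1 zw E1 by auto
  define T where "T = Moebius_function 0 c"
  have c1: "cmod c < 1" using c by simp
  define S where "S = T ` E"
  have norm_T: "cmod (T \<zeta>) \<le> k" if "\<zeta> \<in> E" for \<zeta>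
    using le[OF that] phd_commute[of c \<zeta>] by (simp add: T_def phd_def k)
  have phd_T: "phd (T x) (T y) = phd x y" if "cmod x < 1" "cmod y < 1" for x y
    unfolding T_def by (rule phd_Moebius) (use c1 that in auto)
  have "compact S"
    unfolding S_def T_def
    by (intro compact_continuous_image E holomorphic_on_imp_continuous_on
        holomorphic_on_subset[OF Moebius_function_holomorphic[OF c1] E(3)])
  moreover have S_cball: "S \<subseteq> cball 0 k" using norm_T by (auto simp: S_def)
  \<comment> \<open>Optimality survives the change of coordinates: the competitor \<open>c'\<close>
    is pulled back by the inverse Moebius map, which has parameter \<open>- c\<close>.\<close>
  moreover have "\<exists>\<zeta>\<in>S. k \<le> phd c' \<zeta>" if "c' \<in> ball 0 1" for c'
  proof -
    define d where "d = Moebius_function 0 (- c) c'"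
    have d: "cmod d < 1" "T d = c'"
      using that c1 by (auto simp: d_def T_def Moebius_function_norm_lt_1 Moebius_function_compose)
    then obtain \<zeta> where "\<zeta> \<in> E" "k \<le> phd d \<zeta>" using opt[of d] k by auto
    then have "T \<zeta> \<in> S" "k \<le> phd c' (T \<zeta>)"
      using phd_T[of d \<zeta>] d E1 by (auto simp: S_def)
    then show ?thesis by blast
  qed
  ultimately have "0 \<in> convex hull (S \<inter> sphere 0 k)"
    using k01 by (intro circumcenter_in_hull)
  \<comment> \<open>The real dimension of the plane is 2, so the bound is k^2 cos(120
    degrees).\<close>
  then obtain a b where ab: "a \<in> S" "b \<in> S" "cmod a = k" "cmod b = k" "a \<bullet> b \<le> - (k\<^sup>2 / 2)"
    by (rule zero_in_hull_sphere_pair[of _ k]) auto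
  have ab_q: "phd a b \<le> q"
    using ab zw_max phd_T E1 by (auto simp: S_def q)
  have "(cmod (a - b))\<^sup>2 = (cmod a)\<^sup>2 - 2 * (a \<bullet> b) + (cmod b)\<^sup>2"
    by (simp add: power2_norm_eq_inner inner_diff inner_commute[of b a])
  then have "3 * k\<^sup>2 * (1 - q\<^sup>2) \<le> (cmod (a - b))\<^sup>2 * (1 - q\<^sup>2)"
    using ab(3-5) q01 by (intro mult_right_mono) (auto simp: power_le_one_iff)
  also have "\<dots> \<le> q\<^sup>2 * ((1 - k\<^sup>2) * (1 - k\<^sup>2))"
  proof -
    have "\<not> q\<^sup>2 * ((1 - k\<^sup>2) * (1 - k\<^sup>2)) < (cmod (a - b))\<^sup>2 * (1 - q\<^sup>2)"
    proof
      assume *: "q\<^sup>2 * ((1 - k\<^sup>2) * (1 - k\<^sup>2)) < (cmod (a - b))\<^sup>2 * (1 - q\<^sup>2)"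
      have "(cmod (a - b))\<^sup>2 \<le> q\<^sup>2 * (cmod (1 - cnj b * a))\<^sup>2"
        using ab_q ab k01 phd_le_iff[of a b q] power_mono[of "cmod (a - b)" "q * cmod (1 - cnj b * a)" 2]
        by (simp add: power_mult_distrib)
      then show False
        using * ab(3,4) unfolding cmod_one_minus_cnj_mult_power2 by (simp add: algebra_simps)
    qed
    then show ?thesis by simp
  qed
  finally show "3 * k\<^sup>2 * (1 - q\<^sup>2) \<le> q\<^sup>2 * (1 - k\<^sup>2)\<^sup>2" by (simp add: power2_eq_square)
  \<comment> \<open>The lower bound uses the images of the diametral pair, both of modulus at most
    \<open>k\<close>.\<close>
  define u v where "u = T z" and "v = T w"
  have uv: "cmod u \<le> k" "cmod v \<le> k" "phd u v = q"
    using norm_T zw phd_T E1 by (auto simp: u_def v_def q)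
  have "(1 - k\<^sup>2)\<^sup>2 \<le> (1 - (cmod u)\<^sup>2) * (1 - (cmod v)\<^sup>2)"
    unfolding power2_eq_square[of "1 - k\<^sup>2"] using uv k01
    by (intro mult_mono) (auto simp: power_mono power_le_one_iff intro: order.trans)
  then have "q\<^sup>2 * (1 - k\<^sup>2)\<^sup>2 \<le> q\<^sup>2 * ((1 - (cmod u)\<^sup>2) * (1 - (cmod v)\<^sup>2))"
    by (intro mult_left_mono) auto
  also have "\<dots> \<le> (cmod (u - v))\<^sup>2 * (1 - q\<^sup>2)"
    using phd_less_iff[of u v q] uv k01 q01 by auto
  also have "\<dots> \<le> (2 * k)\<^sup>2 * (1 - q\<^sup>2)"
    using norm_triangle_ineq4[of u v] uv q01
    by (intro mult_right_mono power_mono) (auto simp: power_le_one_iff)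
  finally show "q\<^sup>2 * (1 - k\<^sup>2)\<^sup>2 \<le> (2 * k)\<^sup>2 * (1 - q\<^sup>2)" .
qed

section \<open>Solving for the radius\<close>

text \<open>Put k = tan(t/2), so that 2k/(1 + k^2) = sin t and (1 - k^2)/(1 + k^2) = cos t. The
  hypothesis says q \<le> sin t, hence cos t \<le> sqrt(1 - q^2), and k = sin t / (1 + cos t) gives
  the claim.\<close>

lemma radius_lower_bound:
  fixes k q :: real
  assumes k: "0 \<le> k" "k < 1" and q: "0 \<le> q" "q < 1"
    and le: "q\<^sup>2 * (1 - k\<^sup>2)\<^sup>2 \<le> (2 * k)\<^sup>2 * (1 - q\<^sup>2)"
  shows "q / (1 + sqrt (1 - q\<^sup>2)) \<le> k"
proof -
  have p: "1 + k\<^sup>2 > 0" by (simp add: add_pos_nonneg)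
  have "(q * (1 + k\<^sup>2))\<^sup>2 \<le> (2 * k)\<^sup>2"
    using le by (simp add: algebra_simps power2_eq_square)
  then have 1: "q * (1 + k\<^sup>2) \<le> 2 * k"
    by (rule power2_le_imp_le) (use k in simp)
  have "((1 - k\<^sup>2) / (1 + k\<^sup>2))\<^sup>2 \<le> 1 - q\<^sup>2"
  proof -
    have "(1 - k\<^sup>2)\<^sup>2 \<le> (1 - q\<^sup>2) * (1 + k\<^sup>2)\<^sup>2"
      using le by (simp add: algebra_simps power2_eq_square)
    then show ?thesis using p by (simp add: power_divide divide_le_eq)
  qed
  then have "(1 - k\<^sup>2) / (1 + k\<^sup>2) \<le> sqrt (1 - q\<^sup>2)" by (rule real_le_rsqrt)
  then have "2 / (1 + k\<^sup>2) \<le> 1 + sqrt (1 - q\<^sup>2)"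
    using p by (simp add: field_simps)
  then have "k * (2 / (1 + k\<^sup>2)) \<le> k * (1 + sqrt (1 - q\<^sup>2))"
    using k by (intro mult_left_mono)
  moreover have "q \<le> k * (2 / (1 + k\<^sup>2))"
    using 1 p by (simp add: field_simps)
  moreover have "0 < 1 + sqrt (1 - q\<^sup>2)"
    using q by (simp add: add_pos_nonneg power_le_one_iff)
  ultimately show ?thesis by (subst pos_divide_le_eq) linarith+
qed

text \<open>Taking roots gives q k^2 + B k - q \<le> 0, a quadratic with discriminant B^2 + 4 q^2 =
  A^2. For q > 0 its positive root (A - B)/(2q) equals 2q/(A + B) because A^2 - B^2 = 4 q^2.\<close>

lemma radius_upper_bound:
  fixes k q :: real
  assumes k: "0 \<le> k" "k < 1" and q: "0 \<le> q" "q < 1"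
    and le: "3 * k\<^sup>2 * (1 - q\<^sup>2) \<le> q\<^sup>2 * (1 - k\<^sup>2)\<^sup>2"
  shows "k \<le> jung q"
proof -
  define A B where "A = sqrt (3 + q\<^sup>2)" and "B = sqrt (3 * (1 - q\<^sup>2))"
  have q1: "q\<^sup>2 < 1" using q by (simp add: power_less_one_iff)
  have A: "A > 0" "A\<^sup>2 = 3 + q\<^sup>2" by (auto simp: A_def add_pos_nonneg)
  have B: "B > 0" "B\<^sup>2 = 3 * (1 - q\<^sup>2)" using q1 by (auto simp: B_def)
  have "(B * k)\<^sup>2 \<le> (q * (1 - k\<^sup>2))\<^sup>2"
    using le unfolding power_mult_distrib B(2) by (simp only: ac_simps)
  moreover have "0 \<le> q * (1 - k\<^sup>2)" using q k by (simp add: power_le_one_iff)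
  ultimately have Bk: "B * k \<le> q * (1 - k\<^sup>2)" by (rule power2_le_imp_le)
  have "k * (A + B) \<le> 2 * q"
  proof (cases "q = 0")
    case True
    then have "k = 0" using Bk B(1) k by (simp add: mult_le_0_iff)
    then show ?thesis using q by simp
  next
    case False
    then have q0: "q > 0" using q by simp
    \<comment> \<open>The factor 4q completes the square.\<close>
    have "4 * q * (B * k) \<le> 4 * q * (q * (1 - k\<^sup>2))"
      using Bk q by (intro mult_left_mono) auto
    then have "(2 * q * k + B)\<^sup>2 \<le> A\<^sup>2"
      unfolding A(2) power2_sum B(2) by (simp add: algebra_simps power2_eq_square)
    then have "2 * q * k + B \<le> A" by (rule power2_le_imp_le) (use A(1) in simp)
    then have "(2 * q * k) * (A + B) \<le> (A - B) * (A + B)"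
      using A B by (intro mult_right_mono) auto
    also have "\<dots> = (2 * q) * (2 * q)"
      using A(2) B(2) by (simp add: algebra_simps power2_eq_square)
    finally have "(2 * q) * (k * (A + B)) \<le> (2 * q) * (2 * q)" by (simp add: algebra_simps)
    then show ?thesis using q0 by simp
  qed
  then show ?thesis
    using A B unfolding jung_def A_def[symmetric] B_def[symmetric] by (simp add: le_divide_eq)
qed

text \<open>The first root in the denominator alone exceeds 2q, since 4 q^2 < 3 + q^2. This keeps
  the upper bound for \<open>K_aff\<close> away from its pole.\<close>

lemma jung_lt_1:
  assumes "0 \<le> q" "q < 1"
  shows "jung q < 1"
proof -
  have q1: "q\<^sup>2 < 1" using assms by (simp add: power_less_one_iff)
  have "(2 * q)\<^sup>2 < 3 + q\<^sup>2" using q1 by (simp add: power_mult_distrib)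
  then have "2 * q < sqrt (3 + q\<^sup>2)" by (rule real_less_rsqrt)
  moreover have "sqrt (3 * (1 - q\<^sup>2)) > 0" using q1 by simp
  ultimately show ?thesis
    using assms unfolding jung_def by (subst divide_less_eq_1_pos) linarith+
qed

text \<open>With q = tanh(d/2) the number x is tanh(d/4), and both sides equal exp(d/2). The
  algebraic proof uses only p^2 + q^2 = 1 and signs.\<close>

lemma half_angle_quotient:
  fixes q :: real
  assumes q: "0 \<le> q" "q < 1"
  defines "x \<equiv> q / (1 + sqrt (1 - q\<^sup>2))"
  shows "(1 + x) / (1 - x) = sqrt ((1 + q) / (1 - q))"
proof -
  define p where "p = sqrt (1 - q\<^sup>2)"
  have q1: "q\<^sup>2 < 1" using q by (simp add: power_less_one_iff)
  have p: "p > 0" "p\<^sup>2 = 1 - q\<^sup>2" using q1 by (auto simp: p_def)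
  have x: "x = q / (1 + p)" by (simp add: x_def p_def)
  have "1 + x = (1 + p + q) / (1 + p)" "1 - x = (1 + p - q) / (1 + p)"
    using p(1) by (auto simp: x field_simps)
  then have "(1 + x) / (1 - x) = (1 + p + q) / (1 + p - q)"
    using p(1) by simp
  moreover have "((1 + p + q) / (1 + p - q))\<^sup>2 = (1 + q) / (1 - q)"
  proof -
    have "(1 + p + q)\<^sup>2 * (1 - q) = (1 + q) * (1 + p - q)\<^sup>2"
      using p(2) by algebra
    moreover have "1 + p - q \<noteq> 0" using p q by simp
    ultimately show ?thesis using q by (simp add: power_divide frac_eq_eq)
  qed
  ultimately show ?thesis
    using p(1) q by (intro real_sqrt_unique[symmetric]) auto
qed

lemma cayley_mono:
  fixes x y :: real
  assumes "0 \<le> x" "x \<le> y" "y < 1"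
  shows "(1 + x) / (1 - x) \<le> (1 + y) / (1 - y)"
  using assms by (intro frac_le) auto

section \<open>Dilatations\<close>

lemma cmod_dilatation_lt_1:
  assumes "orientation_preserving_harmonic f" "z \<in> unit_disk"
  shows "cmod (dilatation f z) < 1"
proof -
  obtain h g where hg: "harmonic_decomp f h g" "(cmod (deriv g z))\<^sup>2 < (cmod (deriv h z))\<^sup>2"
    using assms unfolding orientation_preserving_harmonic_def by force
  then have "cmod (deriv g z) < cmod (deriv h z)" by (simp add: power2_less_imp_less)
  then have "cmod (deriv g z / deriv h z) < 1"
    by (auto simp: norm_divide divide_less_eq)
  then show ?thesis by (simp add: dilatation_eq[OF hg(1) assms(2)])
qed

text \<open>The range lies in a closed disk whose radius is the supremum norm, and so does its
  closure; this radius is below 1.\<close>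

lemma E_aff_compact:
  assumes "orientation_preserving_harmonic f" "sup_norm_disk (dilatation f) < 1"
  shows "compact (E_aff f)" "E_aff f \<noteq> {}" "E_aff f \<subseteq> ball 0 1"
proof -
  have "bdd_above ((\<lambda>z. cmod (dilatation f z)) ` unit_disk)"
    using cmod_dilatation_lt_1[OF assms(1)] by (intro bdd_aboveI2[where M = 1]) (simp add: less_imp_le)
  then have "cmod (dilatation f z) \<le> sup_norm_disk (dilatation f)" if "z \<in> unit_disk" for z
    unfolding sup_norm_disk_def using that by (intro cSUP_upper)
  then have "dilatation f ` unit_disk \<subseteq> cball 0 (sup_norm_disk (dilatation f))" by auto
  then have sub: "E_aff f \<subseteq> cball 0 (sup_norm_disk (dilatation f))"
    unfolding E_aff_def by (intro closure_minimal) auto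
  then show "E_aff f \<subseteq> ball 0 1" using assms(2) by (force simp: subset_eq)
  have "bounded (E_aff f)" using sub bounded_cball bounded_subset by blast
  then show "compact (E_aff f)"
    by (simp add: compact_eq_bounded_closed E_aff_def)
  show "E_aff f \<noteq> {}" by (simp add: E_aff_def)
qed

theorem corollary5p6:
  fixes f :: "complex \<Rightarrow> complex" and q :: real
  assumes "orientation_preserving_harmonic f"
    and "sup_norm_disk (dilatation f) < 1"
    and "q = q_aff f"
  shows "0 \<le> q \<and> q < 1 \<and>
    k_aff f \<ge> q / (1 + sqrt (1 - q\<^sup>2)) \<and>
    k_aff f \<le> jung q \<and>
    sqrt ((1 + q) / (1 - q)) \<le> K_aff f \<and>
    K_aff f \<le> (1 + jung q) / (1 - jung q)"
proof -
  have k: "k_aff f = tanh (hyp_rad (E_aff f) / 2)" and q: "q = tanh (hyp_diam (E_aff f) / 2)"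
    by (auto simp: assms(3) k_aff_def r_aff_def q_aff_def d_aff_def)
  note J = hyperbolic_jung[OF E_aff_compact[OF assms(1,2)], folded k q]
  have low: "q / (1 + sqrt (1 - q\<^sup>2)) \<le> k_aff f" by (rule radius_lower_bound) fact+
  have up: "k_aff f \<le> jung q" by (rule radius_upper_bound) fact+
  \<comment> \<open>The map x to (1 + x)/(1 - x) increases on [0, 1), so both bounds pass from
    \<open>k_aff\<close> to \<open>K_aff\<close>.\<close>
  have "0 \<le> q / (1 + sqrt (1 - q\<^sup>2))"
    using J(3,4) by (simp add: power_le_one_iff)
  then have "sqrt ((1 + q) / (1 - q)) \<le> K_aff f"
    unfolding K_aff_def half_angle_quotient[OF J(3,4), symmetric] using low J(2)
    by (rule cayley_mono)
  moreover have "K_aff f \<le> (1 + jung q) / (1 - jung q)"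
    unfolding K_aff_def using J(1) up jung_lt_1[OF J(3,4)] by (rule cayley_mono)
  ultimately show ?thesis using J(3,4) low up by simp
qed

end
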